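(* Let $t\ge 2$ be an integer. For every $\epsilon>0$ and every finite family $\mathcal{F}$ of $t$-uniform hypergraphs such that no member of $\mathcal{F}$ appears as a sub-hypergraph of any $(t-1)$-blown-up hypergraph $G^{(t-1)}$ (over all $t$-uniform hypergraphs $G$), there is a $t$-uniform hypergraph $T$ that contains no member of $\mathcal{F}$ as a sub-hypergraph but satisfies $\tau(T)\ge (t-\epsilon)\tau^*(T)$, and in particular $\tau(T)\ge (t-\epsilon)\nu(T)$.
   Context: For a $t$-uniform hypergraph $G=(V,E)$, the $(t-1)$-blown-up hypergraph $G^{(t-1)}$ has as vertices all $(t-1)$-element subsets of $V$ contained in some edge of $G$, and for each edge $e\in E$ it has the edge consisting of all $(t-1)$-element subsets of $e$. A hypergraph contains $F$ as a sub-hypergraph if some subset of its vertices and edges forms a hypergraph isomorphic to $F$. For a hypergraph $H$: $\tau(H)$ is the minimum size of a vertex cover (set of vertices meeting every edge), $\nu(H)$ is the maximum number of pairwise disjoint edges, and $\tau^*(H)=\min\{\sum_v x_v: x_v\ge0,\ \sum_{v\in e}x_v\ge 1\ \forall e\}$ is the fractional vertex cover number. *)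

theory Defs
  imports Complex_Main "HOL-Library.Disjoint_Sets"
begin

record 'a hypergraph =
  verts :: "'a set"
  edges :: "'a set set"

text \<open>Hypergraphs are finite and simple; isolated vertices and empty edge sets are allowed.\<close>

definition hypergraph :: "'a hypergraph \<Rightarrow> bool" where
  "hypergraph H \<longleftrightarrow> finite (verts H) \<and> (\<forall>e\<in>edges H. e \<subseteq> verts H)"

definition uniform_hypergraph :: "nat \<Rightarrow> 'a hypergraph \<Rightarrow> bool" where
  "uniform_hypergraph t H \<longleftrightarrow> hypergraph H \<and> (\<forall>e\<in>edges H. card e = t)"

definition hypergraph_iso :: "'a hypergraph \<Rightarrow> 'b hypergraph \<Rightarrow> bool" where
  "hypergraph_iso H K \<longleftrightarrow>
     (\<exists>f. bij_betw f (verts H) (verts K) \<and> edges K = (\<lambda>e. f ` e) ` edges H)"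

text \<open>Sub-hypergraphs need not be induced.\<close>

definition contains_subhypergraph :: "'b hypergraph \<Rightarrow> 'a hypergraph \<Rightarrow> bool" where
  "contains_subhypergraph H F \<longleftrightarrow>
     (\<exists>K. hypergraph K \<and> verts K \<subseteq> verts H \<and> edges K \<subseteq> edges H \<and> hypergraph_iso F K)"

text \<open>With \<open>k = t - 1\<close> this is the blown-up hypergraph of a \<open>t\<close>-uniform hypergraph.\<close>

definition blown_up :: "nat \<Rightarrow> 'a hypergraph \<Rightarrow> 'a set hypergraph" where
  "blown_up k G =
     \<lparr> verts = {s. card s = k \<and> (\<exists>e\<in>edges G. s \<subseteq> e)},
       edges = (\<lambda>e. {s. s \<subseteq> e \<and> card s = k}) ` edges G \<rparr>"

definition vertex_cover :: "'a hypergraph \<Rightarrow> 'a set \<Rightarrow> bool" where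
  "vertex_cover H C \<longleftrightarrow> C \<subseteq> verts H \<and> (\<forall>e\<in>edges H. C \<inter> e \<noteq> {})"

definition vertex_cover_number :: "'a hypergraph \<Rightarrow> nat" where
  "vertex_cover_number H = Min {card C | C. vertex_cover H C}"

definition matching :: "'a hypergraph \<Rightarrow> 'a set set \<Rightarrow> bool" where
  "matching H M \<longleftrightarrow> M \<subseteq> edges H \<and> disjoint M"

definition matching_number :: "'a hypergraph \<Rightarrow> nat" where
  "matching_number H = Max {card M | M. matching H M}"

definition fractional_vertex_cover :: "'a hypergraph \<Rightarrow> ('a \<Rightarrow> real) \<Rightarrow> bool" where
  "fractional_vertex_cover H x \<longleftrightarrow>
     (\<forall>v\<in>verts H. 0 \<le> x v) \<and> (\<forall>e\<in>edges H. 1 \<le> (\<Sum>v\<in>e. x v))"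

text \<open>
  The infimum is a minimum for finite hypergraphs with nonempty edges, being the
  optimal value of a feasible linear program that is bounded below by \<open>0\<close>.
\<close>

definition fractional_vertex_cover_number :: "'a hypergraph \<Rightarrow> real" where
  "fractional_vertex_cover_number H =
     Inf {(\<Sum>v\<in>verts H. x v) | x. fractional_vertex_cover H x}"

end

theory Submission
  imports Defs "HOL-Library.FuncSet"
begin

text \<open>
  Call a set of \<open>k\<close> edges of a \<open>t\<close>-uniform hypergraph dense if it spans at most \<open>(t - 1) k\<close>
  vertices. A hypergraph without a nonempty dense set of edges is a forest, and forests embed into
  blown-up hypergraphs edge by edge; hence every member of \<open>\<F>\<close> contains a nonempty dense set of
  edges. Conversely, among \<open>K n\<close> random \<open>t\<close>-tuples of vertices in \<open>{..<n}\<close>, with \<open>K\<close> a large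
  constant, the expected number of dense sets of bounded size is \<open>O(1)\<close>, while a first moment bound
  shows that no set of \<open>n / q\<close> vertices is independent. Deleting one edge from each dense set
  destroys all members of \<open>\<F>\<close> and raises the independence number by \<open>O(1)\<close> only, so that
  \<open>\<tau>\<close> is close to \<open>n\<close>, whereas \<open>\<tau>\<^sup>*\<close> and \<open>\<nu>\<close> are at most \<open>n / t\<close>.
\<close>

section \<open>Embedding forests into blown-up hypergraphs\<close>

text \<open>The family \<open>G\<close> plays the edge set of a hypergraph on
  \<open>\<Union>G\<close>, and \<open>f\<close> sends the vertices injectively to vertices of its
  blow-up, edges onto whole blown-up edges. Naturals serve as ground set so that fresh elements
  never run out; \<open>V\<close> is separate from \<open>\<Union>E\<close> because isolated
  vertices have to be placed too.\<close>

definition embeds :: "nat \<Rightarrow> 'a set \<Rightarrow> 'a set set \<Rightarrow> bool" where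
  "embeds t V E \<longleftrightarrow> (\<exists>(f :: 'a \<Rightarrow> nat set) G. finite G \<and> (\<forall>g\<in>G. card g = t) \<and> inj_on f V \<and>
     (\<forall>v\<in>V. card (f v) = t - 1 \<and> (\<exists>g\<in>G. f v \<subseteq> g)) \<and>
     (\<forall>e\<in>E. \<exists>g\<in>G. f ` e = {s. s \<subseteq> g \<and> card s = t - 1}))"

lemma embeds_empty: "embeds t {} {}"
  unfolding embeds_def by (rule exI, rule exI[of _ "{}"]) auto

text \<open>An isolated vertex is sent to a (t-1)-subset of a new edge that is disjoint from all old
  ones.\<close>

lemma embeds_insert_vertex:
  assumes t: "t \<ge> 2" and emb: "embeds t V E" and w: "w \<notin> V" and sub: "\<Union>E \<subseteq> V"
  shows "embeds t (insert w V) E"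
proof -
  obtain f :: "'a \<Rightarrow> nat set" and G where G: "finite G" "\<forall>g\<in>G. card g = t" and inj: "inj_on f V"
    and fV: "\<forall>v\<in>V. card (f v) = t - 1 \<and> (\<exists>g\<in>G. f v \<subseteq> g)"
    and fE: "\<forall>e\<in>E. \<exists>g\<in>G. f ` e = {s. s \<subseteq> g \<and> card s = t - 1}"
    using emb unfolding embeds_def by auto
  have "finite (\<Union>G)" using G t by (intro finite_Union) (auto intro: card_ge_0_finite)
  then have "infinite (UNIV - \<Union>G)" by (simp add: Diff_infinite_finite)
  from infinite_arbitrarily_large[OF this, of t]
  obtain g where g: "finite g" "card g = t" "g \<subseteq> UNIV - \<Union>G" by auto
  obtain s where s: "s \<subseteq> g" "card s = t - 1" "finite s"
    using obtain_subset_with_card_n[of "t - 1" g] g by auto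
  \<comment> \<open>This is where t \<ge> 2 enters: old images lie inside \<open>\<Union>G\<close>,
    which \<open>s\<close> avoids, so only an empty \<open>s\<close> could coincide with one of
    them.\<close>
  have "s \<noteq> {}" using s t by auto
  then have new: "f v \<noteq> s" if "v \<in> V" for v using fV that s g by blast
  define f' where "f' = f(w := s)"
  have eq: "f' ` e = f ` e" if "e \<in> E" for e
    using that w sub by (auto simp: f'_def)
  have inj': "inj_on f' (insert w V)"
    using inj new w by (auto simp: f'_def inj_on_def)
  show ?thesis unfolding embeds_def
  proof (rule exI[of _ f'], rule exI[of _ "insert g G"], intro conjI)
    show "\<forall>v\<in>insert w V. card (f' v) = t - 1 \<and> (\<exists>g\<in>insert g G. f' v \<subseteq> g)"
      using fV s by (auto simp: f'_def)
    show "\<forall>e\<in>E. \<exists>g\<in>insert g G. f' ` e = {s. s \<subseteq> g \<and> card s = t - 1}"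
      using fE eq by auto
  qed (use G g inj' in auto)
qed

text \<open>Adding one fresh element \<open>x\<close> to \<open>f v\<close> gives a t-set
  \<open>g\<close>. Its (t-1)-subsets are \<open>f v\<close> itself and t-1 sets containing
  \<open>x\<close>. The latter differ from all old images, so they can serve as images of the t-1
  new vertices of \<open>e\<close>.\<close>

lemma embeds_insert_edge:
  assumes t: "t \<ge> 2" and emb: "embeds t V E" and e: "card e = t" "e \<inter> V = {v}"
    and sub: "\<Union>E \<subseteq> V"
  shows "embeds t (V \<union> e) (insert e E)"
proof -
  obtain f :: "'a \<Rightarrow> nat set" and G where G: "finite G" "\<forall>g\<in>G. card g = t" and inj: "inj_on f V"
    and fV: "\<forall>v\<in>V. card (f v) = t - 1 \<and> (\<exists>g\<in>G. f v \<subseteq> g)"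
    and fE: "\<forall>e\<in>E. \<exists>g\<in>G. f ` e = {s. s \<subseteq> g \<and> card s = t - 1}"
    using emb unfolding embeds_def by auto
  have v: "v \<in> V" "v \<in> e" using e by auto
  have fin_e: "finite e" using e t by (auto intro: card_ge_0_finite)
  have "finite (\<Union>G)" using G t by (intro finite_Union) (auto intro: card_ge_0_finite)
  then obtain x where x: "x \<notin> \<Union>G" using ex_new_if_finite infinite_UNIV_nat by blast
  define g where "g = insert x (f v)"
  have s: "card (f v) = t - 1" "x \<notin> f v" using fV v x by auto
  then have "finite (f v)" using t by (auto intro: card_ge_0_finite)
  then have g: "finite g" "card g = t" using s t by (auto simp: g_def)
  define S where "S = {u. u \<subseteq> g \<and> card u = t - 1}"
  have S: "finite S" using g by (auto simp: S_def)
  have "t choose (t - 1) = t" using t binomial_symmetric[of "t - 1" t] by simp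
  then have "card S = t" using n_subsets[OF g(1), of "t - 1"] g(2) by (simp add: S_def)
  moreover have fvS: "f v \<in> S" using s by (auto simp: S_def g_def)
  ultimately have "card (e - {v}) = card (S - {f v})" using e v by simp
  then obtain h where h: "bij_betw h (e - {v}) (S - {f v})"
    using finite_same_card_bij S fin_e by (metis finite_Diff)
  have xS: "x \<in> u" if "u \<in> S - {f v}" for u
  proof (rule ccontr)
    assume "x \<notin> u"
    then have "u \<subseteq> f v" "card u = card (f v)" using that s by (auto simp: S_def g_def)
    then have "u = f v" using \<open>finite (f v)\<close> by (simp add: card_subset_eq)
    then show False using that by auto
  qed
  have hS: "h u \<in> S - {f v}" if "u \<in> e - {v}" for u
    using h that by (rule bij_betw_apply)
  have xh: "x \<in> h u" "h u \<in> S" if "u \<in> e - {v}" for u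
    using hS[OF that] xS by blast+
  have xf: "x \<notin> f u" if "u \<in> V" for u using that fV x by auto
  define f' where "f' u = (if u \<in> V then f u else h u)" for u
  have eq: "f' ` d = f ` d" if "d \<in> E" for d
    using that sub by (auto simp: f'_def)
  have "f' ` e = insert (f' v) (f' ` (e - {v}))" using v by auto
  also have "f' ` (e - {v}) = h ` (e - {v})" using e by (intro image_cong) (auto simp: f'_def)
  also have "\<dots> = S - {f v}" using h by (simp add: bij_betw_def)
  finally have eqe: "f' ` e = S" using v fvS by (auto simp: f'_def)
  have injh: "inj_on h (e - {v})" using h by (simp add: bij_betw_def)
  have inj': "inj_on f' (V \<union> e)"
  proof (rule inj_onI)
    fix a b assume ab: "a \<in> V \<union> e" "b \<in> V \<union> e" "f' a = f' b"
    have nV: "u \<in> e - {v}" if "u \<in> V \<union> e" "u \<notin> V" for u using that e by auto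
    show "a = b"
    proof (cases "a \<in> V"; cases "b \<in> V")
      assume "a \<in> V" "b \<in> V" then show ?thesis using ab inj by (auto simp: f'_def inj_on_def)
    next
      assume "a \<in> V" "b \<notin> V" then show ?thesis using ab nV xh(1)[of b] xf[of a] by (auto simp: f'_def)
    next
      assume "a \<notin> V" "b \<in> V" then show ?thesis using ab nV xh(1)[of a] xf[of b] by (auto simp: f'_def)
    next
      assume "a \<notin> V" "b \<notin> V" then show ?thesis
        using ab nV injh by (auto simp: f'_def inj_on_def)
    qed
  qed
  show ?thesis unfolding embeds_def
  proof (rule exI[of _ f'], rule exI[of _ "insert g G"], intro conjI)
    show "\<forall>u\<in>V \<union> e. card (f' u) = t - 1 \<and> (\<exists>g\<in>insert g G. f' u \<subseteq> g)"
    proof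
      fix u assume "u \<in> V \<union> e"
      then consider "u \<in> V" | "u \<in> e - {v}" "u \<notin> V" using e by auto
      then show "card (f' u) = t - 1 \<and> (\<exists>g\<in>insert g G. f' u \<subseteq> g)"
        using fV xh(2)[of u] by cases (auto simp: f'_def S_def)
    qed
    show "\<forall>e\<in>insert e E. \<exists>g\<in>insert g G. f' ` e = {s. s \<subseteq> g \<and> card s = t - 1}"
      using fE eq eqe by (auto simp: S_def)
  qed (use G g inj' in auto)
qed

text \<open>Double counting of degrees. All degrees sum to t|S|, and those of the shared vertices
  \<open>Y\<close> (degree at least 2) sum to at least 2|S|, as every edge has two such vertices.
  Since d \<ge> 1 everywhere, 2 \<le> 2d holds, and 2 + d \<le> 2d where d \<ge> 2; summing over the
  vertices gives 2|X| + 2|S| \<le> 2t|S|.\<close>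

lemma card_Union_le_if_no_leaf:
  assumes fin: "finite S" and t: "t \<ge> 1" and card: "\<forall>e\<in>S. card e = t"
    and leaf: "\<forall>e\<in>S. card (e \<inter> \<Union>(S - {e})) \<ge> 2"
  shows "card (\<Union>S) \<le> (t - 1) * card S"
proof -
  define X where "X = \<Union>S"
  define d where "d v = card {e\<in>S. v \<in> e}" for v
  define Y where "Y = {v\<in>X. d v \<ge> 2}"
  have fin_e: "finite e" if "e \<in> S" for e using that card t by (auto intro: card_ge_0_finite)
  have X: "finite X" using fin fin_e by (auto simp: X_def)
  then have Y: "finite Y" by (simp add: Y_def)
  have "(\<Sum>e\<in>S. card {v\<in>X. v \<in> e}) = (\<Sum>v\<in>X. d v)"
    by (rule sum_multicount_gen) (use fin X in \<open>auto simp: d_def\<close>)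
  moreover have "(\<Sum>e\<in>S. card {v\<in>X. v \<in> e}) = (\<Sum>e\<in>S. t)"
  proof (rule sum.cong)
    fix e assume "e \<in> S"
    then have "{v\<in>X. v \<in> e} = e" by (auto simp: X_def)
    then show "card {v\<in>X. v \<in> e} = t" using card \<open>e \<in> S\<close> by simp
  qed simp
  ultimately have sumX: "(\<Sum>v\<in>X. d v) = t * card S" by (simp add: mult.commute)
  have "(\<Sum>e\<in>S. card {v\<in>Y. v \<in> e}) = (\<Sum>v\<in>Y. d v)"
    by (rule sum_multicount_gen) (use fin Y in \<open>auto simp: d_def\<close>)
  moreover have "(\<Sum>e\<in>S. 2) \<le> (\<Sum>e\<in>S. card {v\<in>Y. v \<in> e})"
  proof (rule sum_mono)
    fix e assume e: "e \<in> S"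
    have "e \<inter> \<Union>(S - {e}) \<subseteq> {v\<in>Y. v \<in> e}"
    proof
      fix v assume v: "v \<in> e \<inter> \<Union>(S - {e})"
      then obtain e' where e': "e' \<in> S" "e' \<noteq> e" "v \<in> e'" by auto
      have "card {e, e'} \<le> d v"
        unfolding d_def using e e' v fin by (intro card_mono) auto
      then show "v \<in> {v\<in>Y. v \<in> e}" using e e' v by (auto simp: Y_def X_def)
    qed
    then have "card (e \<inter> \<Union>(S - {e})) \<le> card {v\<in>Y. v \<in> e}" using Y by (intro card_mono) auto
    then show "2 \<le> card {v\<in>Y. v \<in> e}" using leaf e by (meson order_trans)
  qed
  ultimately have sumY: "2 * card S \<le> (\<Sum>v\<in>Y. d v)" by simp
  have d1: "d v \<ge> 1" if "v \<in> X" for v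
    using that fin by (auto simp: d_def X_def Suc_le_eq card_gt_0_iff)
  have "(\<Sum>v\<in>Y. d v) = (\<Sum>v\<in>X. if d v \<ge> 2 then d v else 0)"
    unfolding Y_def using X by (simp add: sum.inter_filter)
  then have "2 * card X + (\<Sum>v\<in>Y. d v) = (\<Sum>v\<in>X. 2 + (if d v \<ge> 2 then d v else 0))"
    by (subst sum.distrib) simp
  also have "\<dots> \<le> (\<Sum>v\<in>X. 2 * d v)"
  proof (rule sum_mono)
    fix v assume "v \<in> X"
    then show "2 + (if d v \<ge> 2 then d v else 0) \<le> 2 * d v" using d1[of v] by simp
  qed
  also have "\<dots> = 2 * (t * card S)" using sumX by (simp add: sum_distrib_left[symmetric])
  finally have "card X + card S \<le> t * card S" using sumY by linarith
  moreover have "t * card S = (t - 1) * card S + card S" using t by (cases t) auto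
  ultimately show ?thesis by (simp add: X_def)
qed

text \<open>Induction on the number of edges. As \<open>E\<close> itself is not dense, the previous
  count yields a leaf: an edge meeting the union of the others in at most one vertex. It is removed,
  the rest is embedded, and the leaf is attached again. \<open>W\<close> holds the isolated
  vertices.\<close>

lemma embeds_forest:
  assumes t: "t \<ge> 2" and fin: "finite W" "finite E" and card: "\<forall>e\<in>E. card e = t"
    and disj: "W \<inter> \<Union>E = {}"
    and sparse: "\<forall>S\<subseteq>E. S \<noteq> {} \<longrightarrow> card (\<Union>S) > (t - 1) * card S"
  shows "embeds t (W \<union> \<Union>E) E"
  using fin(2) card disj sparse
proof (induction "card E" arbitrary: E)
  case 0
  have "embeds t W {}" using fin(1)
  proof induction
    case (insert w W)
    show ?case by (rule embeds_insert_vertex[OF t insert.IH insert.hyps(2)]) simp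
  qed (rule embeds_empty)
  then show ?case using 0 by auto
next
  case (Suc k)
  have "E \<noteq> {}" using Suc.hyps by auto
  then have "\<not> card (\<Union>E) \<le> (t - 1) * card E" using Suc.prems(4) by (simp add: not_le)
  moreover have "t \<ge> 1" using t by simp
  ultimately have "\<not> (\<forall>e\<in>E. card (e \<inter> \<Union>(E - {e})) \<ge> 2)"
    using card_Union_le_if_no_leaf[OF Suc.prems(1) _ Suc.prems(2)] by blast
  then obtain e where e: "e \<in> E" "card (e \<inter> \<Union>(E - {e})) < 2" by (auto simp: not_le)
  define E' where "E' = E - {e}"
  define V where "V = W \<union> \<Union>E'"
  have E: "E = insert e E'" using e by (auto simp: E'_def)
  have emb: "embeds t V E'" unfolding V_def
  proof (rule Suc.hyps(1))
    show "k = card E'" using Suc.hyps(2) Suc.prems(1) e(1) by (simp add: E'_def)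
    show "finite E'" "\<forall>e\<in>E'. card e = t" "W \<inter> \<Union>E' = {}"
      using Suc.prems(1-3) by (auto simp: E'_def)
    show "\<forall>S\<subseteq>E'. S \<noteq> {} \<longrightarrow> card (\<Union>S) > (t - 1) * card S"
      using Suc.prems(4) E by (simp add: subset_insertI2)
  qed
  have ce: "card e = t" using e(1) Suc.prems(2) by auto
  then have "finite e" "e \<noteq> {}" using t by (auto intro: card_ge_0_finite)
  have eV: "e \<inter> V = e \<inter> \<Union>(E - {e})" using e(1) Suc.prems(3) by (auto simp: V_def E'_def)
  have sub: "\<Union>E' \<subseteq> V" by (auto simp: V_def)
  \<comment> \<open>A leaf disjoint from the rest is reduced to the other case by first placing one
    of its vertices as an isolated vertex.\<close>
  have "card (e \<inter> V) = 0 \<or> card (e \<inter> V) = 1" using e(2) unfolding eV by linarith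
  then have "embeds t (V \<union> e) (insert e E')"
  proof
    assume "card (e \<inter> V) = 0"
    then have "e \<inter> V = {}" using \<open>finite e\<close> by auto
    obtain v where v: "v \<in> e" using \<open>e \<noteq> {}\<close> by auto
    then have "v \<notin> V" using \<open>e \<inter> V = {}\<close> by auto
    then have "embeds t (insert v V) E'" using embeds_insert_vertex[OF t emb _ sub] by simp
    moreover have "e \<inter> insert v V = {v}" using \<open>e \<inter> V = {}\<close> v by auto
    ultimately have "embeds t (insert v V \<union> e) (insert e E')"
      using embeds_insert_edge[OF t _ ce] sub by blast
    moreover have "insert v V \<union> e = V \<union> e" using v by auto
    ultimately show ?thesis by simp
  next
    assume "card (e \<inter> V) = 1"
    then obtain v where "e \<inter> V = {v}" by (auto simp: card_1_singleton_iff)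
    then show ?thesis using embeds_insert_edge[OF t emb ce _ sub] by blast
  qed
  moreover have "V \<union> e = W \<union> \<Union>E" using E by (auto simp: V_def)
  ultimately show ?case using E by simp
qed

section \<open>Dense edge sets in hypergraphs that avoid all blow-ups\<close>

lemma embeds_blown_up:
  assumes t: "t \<ge> 2" and F: "uniform_hypergraph t F" and emb: "embeds t (verts F) (edges F)"
  shows "\<exists>G :: nat hypergraph. uniform_hypergraph t G \<and> contains_subhypergraph (blown_up (t - 1) G) F"
proof -
  obtain f :: "'a \<Rightarrow> nat set" and G where G: "finite G" "\<forall>g\<in>G. card g = t"
    and inj: "inj_on f (verts F)"
    and fV: "\<forall>v\<in>verts F. card (f v) = t - 1 \<and> (\<exists>g\<in>G. f v \<subseteq> g)"
    and fE: "\<forall>e\<in>edges F. \<exists>g\<in>G. f ` e = {s. s \<subseteq> g \<and> card s = t - 1}"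
    using emb unfolding embeds_def by auto
  define H where "H = \<lparr>verts = \<Union>G, edges = G\<rparr>"
  define K where "K = \<lparr>verts = f ` verts F, edges = (\<lambda>e. f ` e) ` edges F\<rparr>"
  have "finite (\<Union>G)" using G t by (intro finite_Union) (auto intro: card_ge_0_finite)
  then have "uniform_hypergraph t H"
    using G by (auto simp: H_def uniform_hypergraph_def hypergraph_def)
  moreover have "hypergraph K"
    using F by (auto simp: K_def uniform_hypergraph_def hypergraph_def)
  moreover have "hypergraph_iso F K"
    using inj by (auto simp: K_def hypergraph_iso_def bij_betw_def)
  moreover have "verts K \<subseteq> verts (blown_up (t - 1) H)"
    using fV by (auto simp: K_def H_def blown_up_def)
  moreover have "edges K \<subseteq> edges (blown_up (t - 1) H)"
    using fE by (auto simp: K_def H_def blown_up_def)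
  ultimately show ?thesis unfolding contains_subhypergraph_def by blast
qed

lemma dense_edges_if_not_in_blown_up:
  assumes t: "t \<ge> 2" and F: "uniform_hypergraph t F"
    and "\<forall>G :: nat hypergraph. uniform_hypergraph t G \<longrightarrow> \<not> contains_subhypergraph (blown_up (t - 1) G) F"
  shows "\<exists>S\<subseteq>edges F. S \<noteq> {} \<and> card (\<Union>S) \<le> (t - 1) * card S"
proof (rule ccontr)
  assume contra: "\<not> ?thesis"
  have V: "finite (verts F)" "\<Union>(edges F) \<subseteq> verts F" "\<forall>e\<in>edges F. card e = t"
    using F by (auto simp: uniform_hypergraph_def hypergraph_def)
  then have "finite (edges F)" by (meson finite_UnionD finite_subset)
  then have "embeds t ((verts F - \<Union>(edges F)) \<union> \<Union>(edges F)) (edges F)"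
    using V contra by (intro embeds_forest[OF t]) (auto simp: not_le)
  moreover have "(verts F - \<Union>(edges F)) \<union> \<Union>(edges F) = verts F" using V by auto
  ultimately show False using embeds_blown_up[OF t F] assms(3) by auto
qed

section \<open>Random hypergraphs\<close>

text \<open>Ordered tuples with repetition make the coordinates independent, so all counts are exact
  powers. The price is that \<open>edge\<close> may have fewer than t elements; such an edge forms a
  dense set by itself and is deleted later.\<close>

definition tuples :: "nat \<Rightarrow> nat set \<Rightarrow> (nat \<Rightarrow> nat) set" where
  "tuples t A = PiE {..<t} (\<lambda>_. A)"

definition edge :: "nat \<Rightarrow> (nat \<Rightarrow> nat \<Rightarrow> nat) \<Rightarrow> nat \<Rightarrow> nat set" where
  "edge t \<omega> i = \<omega> i ` {..<t}"

text \<open>The probability space of M independent uniform tuples; expectations appear below as sums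
  over this finite set.\<close>

definition samples :: "nat \<Rightarrow> nat \<Rightarrow> nat \<Rightarrow> (nat \<Rightarrow> nat \<Rightarrow> nat) set" where
  "samples t n M = PiE {..<M} (\<lambda>_. tuples t {..<n})"

lemma finite_tuples [simp]: "finite A \<Longrightarrow> finite (tuples t A)"
  by (simp add: tuples_def finite_PiE)

lemma card_tuples: "card (tuples t A) = card A ^ t"
  by (simp add: tuples_def card_PiE)

lemma finite_samples [simp]: "finite (samples t n M)"
  by (simp add: samples_def finite_PiE)

lemma card_samples: "card (samples t n M) = n ^ (t * M)"
  by (simp add: samples_def card_PiE card_tuples power_mult)

lemma samples_tuples: "\<omega> \<in> samples t n M \<Longrightarrow> i < M \<Longrightarrow> \<omega> i \<in> tuples t {..<n}"
  by (auto simp: samples_def)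

lemma edge_subset: "\<omega> \<in> samples t n M \<Longrightarrow> i < M \<Longrightarrow> edge t \<omega> i \<subseteq> {..<n}"
  by (auto simp: edge_def tuples_def dest!: samples_tuples)

lemma tuples_if_edge_subset:
  "\<omega> \<in> samples t n M \<Longrightarrow> i < M \<Longrightarrow> edge t \<omega> i \<subseteq> A \<Longrightarrow> \<omega> i \<in> tuples t A"
  by (auto simp: edge_def tuples_def PiE_iff dest!: samples_tuples)

text \<open>Union bound over the sets \<open>U\<close> of exactly s vertices that contain all edges
  indexed by \<open>I\<close>. There are at most n^s of them, and each leaves s^t choices for an
  index in \<open>I\<close> and n^t for any other index.\<close>

lemma card_samples_dense:
  assumes I: "I \<subseteq> {..<M}" and s: "s \<le> n"
  shows "card {\<omega> \<in> samples t n M. card (\<Union>i\<in>I. edge t \<omega> i) \<le> s}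
    \<le> n ^ s * (s ^ (t * card I) * n ^ (t * (M - card I)))"
proof -
  define P where "P U = PiE {..<M} (\<lambda>i. if i \<in> I then tuples t U else tuples t {..<n})" for U
  define \<U> where "\<U> = {U. U \<subseteq> {..<n} \<and> card U = s}"
  have fU: "finite \<U>" by (simp add: \<U>_def)
  have cU: "card \<U> \<le> n ^ s"
    using n_subsets[of "{..<n}" s] binomial_le_pow[OF s] by (simp add: \<U>_def)
  have finU: "finite U" if "U \<in> \<U>" for U using that by (auto simp: \<U>_def intro: finite_subset)
  have fP: "finite (P U)" if "U \<in> \<U>" for U
    unfolding P_def using finU[OF that] by (intro finite_PiE) auto
  have cI: "card ({..<M} - I) = M - card I" using I by (simp add: card_Diff_subset finite_subset)
  have cP: "card (P U) = s ^ (t * card I) * n ^ (t * (M - card I))" if "U \<in> \<U>" for U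
  proof -
    have "card (P U) = (\<Prod>i<M. if i \<in> I then s ^ t else n ^ t)"
      unfolding P_def using that
      by (subst card_PiE) (auto simp: card_tuples \<U>_def intro!: prod.cong)
    also have "\<dots> = (\<Prod>i\<in>{..<M} \<inter> I. s ^ t) * (\<Prod>i\<in>{..<M} - I. n ^ t)"
      by (simp add: prod.If_cases Diff_eq)
    also have "{..<M} \<inter> I = I" using I by auto
    finally show ?thesis using cI by (simp add: power_mult)
  qed
  have "{\<omega> \<in> samples t n M. card (\<Union>i\<in>I. edge t \<omega> i) \<le> s} \<subseteq> (\<Union>U\<in>\<U>. P U)"
  proof
    fix \<omega> assume "\<omega> \<in> {\<omega> \<in> samples t n M. card (\<Union>i\<in>I. edge t \<omega> i) \<le> s}"
    then have \<omega>: "\<omega> \<in> samples t n M" "card (\<Union>i\<in>I. edge t \<omega> i) \<le> s" by auto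
    have "(\<Union>i\<in>I. edge t \<omega> i) \<subseteq> {..<n}" using edge_subset[OF \<omega>(1)] I by blast
    then obtain U where U: "(\<Union>i\<in>I. edge t \<omega> i) \<subseteq> U" "U \<subseteq> {..<n}" "card U = s"
      using exists_subset_between[of "\<Union>i\<in>I. edge t \<omega> i" s "{..<n}"] \<omega>(2) s by auto
    have "\<omega> \<in> P U" unfolding P_def
    proof (rule PiE_I)
      fix i assume i: "i \<in> {..<M}"
      show "\<omega> i \<in> (if i \<in> I then tuples t U else tuples t {..<n})"
        using i U tuples_if_edge_subset[OF \<omega>(1), of i U] samples_tuples[OF \<omega>(1), of i] by auto
    qed (use \<omega> in \<open>auto simp: samples_def PiE_def extensional_def\<close>)
    then show "\<omega> \<in> (\<Union>U\<in>\<U>. P U)" using U by (auto simp: \<U>_def)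
  qed
  then have "card {\<omega> \<in> samples t n M. card (\<Union>i\<in>I. edge t \<omega> i) \<le> s} \<le> card (\<Union>U\<in>\<U>. P U)"
    using fU fP by (intro card_mono) auto
  also have "\<dots> \<le> (\<Sum>U\<in>\<U>. card (P U))" by (rule card_UN_le[OF fU])
  also have "\<dots> = card \<U> * (s ^ (t * card I) * n ^ (t * (M - card I)))" using cP by simp
  also have "\<dots> \<le> n ^ s * (s ^ (t * card I) * n ^ (t * (M - card I)))"
    using cU by (rule mult_right_mono) simp
  finally show ?thesis .
qed

section \<open>Expected number of dense index sets\<close>

definition dense_index_sets :: "nat \<Rightarrow> nat \<Rightarrow> nat \<Rightarrow> (nat \<Rightarrow> nat \<Rightarrow> nat) \<Rightarrow> nat set set" where
  "dense_index_sets t M m \<omega> = {I \<in> {I. I \<subseteq> {..<M} \<and> I \<noteq> {} \<and> card I \<le> m}.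
     card (\<Union>i\<in>I. edge t \<omega> i) \<le> (t - 1) * card I}"

lemma finite_dense_index_sets [simp]: "finite (dense_index_sets t M m \<omega>)"
  by (rule finite_subset[of _ "Pow {..<M}"]) (auto simp: dense_index_sets_def)

text \<open>With M = K n there are at most (K n)^k index sets of size k, and the powers of n cancel:
  k + (t-1)k + t(M-k) = tM is the exponent of the number of samples. Hence the mean is bounded by a
  constant that does not depend on n.\<close>

lemma sum_card_dense_index_sets:
  assumes t: "t \<ge> 1" and n: "(t - 1) * m \<le> n" and M: "M = K * n"
  shows "(\<Sum>\<omega>\<in>samples t n M. card (dense_index_sets t M m \<omega>))
    \<le> (\<Sum>k\<le>m. K ^ k * ((t - 1) * k) ^ (t * k)) * n ^ (t * M)"
proof -
  define J where "J = {I. I \<subseteq> {..<M} \<and> I \<noteq> {} \<and> card I \<le> m}"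
  have J: "finite J" by (rule finite_subset[of _ "Pow {..<M}"]) (auto simp: J_def)
  define b where "b k = n ^ ((t - 1) * k) * (((t - 1) * k) ^ (t * k) * n ^ (t * (M - k)))" for k
  have "(\<Sum>\<omega>\<in>samples t n M. card (dense_index_sets t M m \<omega>))
     = (\<Sum>I\<in>J. card {\<omega>\<in>samples t n M. card (\<Union>i\<in>I. edge t \<omega> i) \<le> (t - 1) * card I})"
    unfolding dense_index_sets_def J_def[symmetric]
    by (rule sum_multicount_gen) (use J in auto)
  also have "\<dots> \<le> (\<Sum>I\<in>J. b (card I))"
  proof (rule sum_mono)
    fix I assume I: "I \<in> J"
    then have "(t - 1) * card I \<le> (t - 1) * m" by (auto simp: J_def)
    then have "(t - 1) * card I \<le> n" using n by linarith
    then show "card {\<omega>\<in>samples t n M. card (\<Union>i\<in>I. edge t \<omega> i) \<le> (t - 1) * card I} \<le> b (card I)"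
      unfolding b_def using I by (intro card_samples_dense) (auto simp: J_def)
  qed
  also have "\<dots> = (\<Sum>k\<in>{..m}. \<Sum>I\<in>{I\<in>J. card I = k}. b (card I))"
    by (rule sum.group[symmetric]) (use J in \<open>auto simp: J_def\<close>)
  also have "\<dots> \<le> (\<Sum>k\<in>{..m}. K ^ k * ((t - 1) * k) ^ (t * k) * n ^ (t * M))"
  proof (rule sum_mono)
    fix k assume "k \<in> {..m}"
    have "(\<Sum>I\<in>{I\<in>J. card I = k}. b (card I)) = card {I\<in>J. card I = k} * b k" by simp
    also have "\<dots> \<le> K ^ k * ((t - 1) * k) ^ (t * k) * n ^ (t * M)"
    proof (cases "k \<le> M")
      case True
      have "card {I\<in>J. card I = k} \<le> card {I. I \<subseteq> {..<M} \<and> card I = k}"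
        by (intro card_mono) (auto simp: J_def)
      also have "\<dots> \<le> M ^ k" using n_subsets[of "{..<M}" k] binomial_le_pow[OF True] by simp
      finally have "card {I\<in>J. card I = k} * b k \<le> M ^ k * b k" by (rule mult_right_mono) simp
      also have "\<dots> = K ^ k * ((t - 1) * k) ^ (t * k) * n ^ (k + (t - 1) * k + t * (M - k))"
        by (simp add: b_def M power_add power_mult_distrib)
      also have "k + (t - 1) * k + t * (M - k) = t * M"
      proof -
        have "k + (t - 1) * k = t * k" using t by (cases t) auto
        then show ?thesis using True by (simp add: distrib_left[symmetric])
      qed
      finally show ?thesis .
    next
      case False
      have none: "card I \<le> M" if "I \<subseteq> {..<M}" for I using card_mono[OF _ that] by simp
      have "{I\<in>J. card I = k} = {}" using False none by (auto simp: J_def)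
      then show ?thesis by (metis card.empty mult_0 le0)
    qed
    finally show "(\<Sum>I\<in>{I\<in>J. card I = k}. b (card I))
      \<le> K ^ k * ((t - 1) * k) ^ (t * k) * n ^ (t * M)" .
  qed
  finally show ?thesis by (simp add: sum_distrib_right)
qed

section \<open>Expected number of independent sets\<close>

definition independent_sets :: "nat \<Rightarrow> nat \<Rightarrow> nat \<Rightarrow> nat \<Rightarrow> (nat \<Rightarrow> nat \<Rightarrow> nat) \<Rightarrow> nat set set" where
  "independent_sets t n M a \<omega> =
     {A \<in> {A. A \<subseteq> {..<n} \<and> card A = a}. \<forall>i<M. \<not> edge t \<omega> i \<subseteq> A}"

lemma finite_independent_sets [simp]: "finite (independent_sets t n M a \<omega>)"
  by (rule finite_subset[of _ "Pow {..<n}"]) (auto simp: independent_sets_def)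

text \<open>For a fixed \<open>A\<close> each of the M tuples independently avoids the a^t tuples
  inside \<open>A\<close>; there are at most 2^n candidates for \<open>A\<close>.\<close>

lemma sum_card_independent_sets:
  "(\<Sum>\<omega>\<in>samples t n M. card (independent_sets t n M a \<omega>)) \<le> 2 ^ n * (n ^ t - a ^ t) ^ M"
proof -
  define \<A> where "\<A> = {A. A \<subseteq> {..<n} \<and> card A = a}"
  have fA: "finite \<A>" by (rule finite_subset[of _ "Pow {..<n}"]) (auto simp: \<A>_def)
  have "card \<A> \<le> card (Pow {..<n})" by (intro card_mono) (auto simp: \<A>_def)
  then have cA: "card \<A> \<le> 2 ^ n" by (simp add: card_Pow)
  have "(\<Sum>\<omega>\<in>samples t n M. card (independent_sets t n M a \<omega>))
     = (\<Sum>A\<in>\<A>. card {\<omega>\<in>samples t n M. \<forall>i<M. \<not> edge t \<omega> i \<subseteq> A})"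
    unfolding independent_sets_def \<A>_def[symmetric]
    by (rule sum_multicount_gen) (use fA in auto)
  also have "\<dots> \<le> (\<Sum>A\<in>\<A>. (n ^ t - a ^ t) ^ M)"
  proof (rule sum_mono)
    fix A assume A: "A \<in> \<A>"
    then have A': "A \<subseteq> {..<n}" "card A = a" "finite A" by (auto simp: \<A>_def intro: finite_subset)
    have sub: "tuples t A \<subseteq> tuples t {..<n}" using A' by (auto simp: tuples_def)
    have "{\<omega>\<in>samples t n M. \<forall>i<M. \<not> edge t \<omega> i \<subseteq> A}
      \<subseteq> PiE {..<M} (\<lambda>_. tuples t {..<n} - tuples t A)" (is "?L \<subseteq> ?R")
    proof
      fix \<omega> assume \<omega>: "\<omega> \<in> ?L"
      have "\<omega> i \<in> tuples t {..<n} - tuples t A" if "i < M" for i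
        using \<omega> that samples_tuples[of \<omega> t n M i] by (auto simp: edge_def tuples_def)
      then show "\<omega> \<in> ?R" using \<omega> by (auto simp: samples_def PiE_iff)
    qed
    then have "card ?L \<le> card ?R" by (intro card_mono finite_PiE) auto
    also have "\<dots> = (n ^ t - a ^ t) ^ M"
      using A' sub by (simp add: card_PiE card_Diff_subset card_tuples)
    finally show "card ?L \<le> (n ^ t - a ^ t) ^ M" .
  qed
  also have "\<dots> \<le> 2 ^ n * (n ^ t - a ^ t) ^ M" using cA by simp
  finally show ?thesis .
qed

lemma ex_sample:
  assumes t: "t \<ge> 1" and q: "q \<ge> 1"
  shows "\<exists>a M. a > 0 \<and> (\<exists>\<omega>\<in>samples t (q * a) M.
    card (dense_index_sets t M m \<omega>) < a \<and> independent_sets t (q * a) M a \<omega> = {})"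
proof -
  \<comment> \<open>\<open>r\<close> is the probability that a random tuple does not lie inside a
    fixed set of n/q vertices. Once r^K < 1/4, the mean number of independent sets is at most 2^n
    r^(K n) \<le> 2^(-n) \<le> 1/2.\<close>
  define r where "r = 1 - 1 / real q ^ t"
  have r: "0 \<le> r" "r < 1" using q by (auto simp: r_def)
  then obtain K where K: "r ^ K < 1 / 4" using real_arch_pow_inv[of "1/4" r] by auto
  \<comment> \<open>\<open>C\<close> bounds the mean number of dense sets whatever n is, so
    \<open>a\<close>, and with it n, may be chosen afterwards: large enough to exceed any count
    below \<open>D\<close> and to make (t-1)m \<le> n.\<close>
  define C where "C = (\<Sum>k\<le>m. K ^ k * ((t - 1) * k) ^ (t * k))"
  define D where "D = 2 * C + 1"
  define a where "a = D + (t - 1) * m"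
  define n where "n = q * a"
  define M where "M = K * n"
  have a: "a \<ge> D" "a > 0" by (auto simp: a_def D_def)
  have "a \<le> n" using q by (simp add: n_def)
  then have n: "(t - 1) * m \<le> n" "n > 0" using a by (auto simp: a_def D_def)
  define N where "N = real n ^ (t * M)"
  have N: "N > 0" using n by (simp add: N_def)
  have dense: "real (\<Sum>\<omega>\<in>samples t n M. card (dense_index_sets t M m \<omega>)) \<le> real C * N"
    using sum_card_dense_index_sets[OF t n(1) M_def]
    unfolding C_def[symmetric] N_def by (metis of_nat_le_iff of_nat_mult of_nat_power)
  have "real (n ^ t - a ^ t) = r * real n ^ t"
  proof -
    have "real (n ^ t - a ^ t) = real n ^ t - real a ^ t"
      using \<open>a \<le> n\<close> by (simp add: of_nat_diff power_mono)
    also have "\<dots> = r * real n ^ t"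
      using q by (simp add: r_def n_def field_simps power_mult_distrib)
    finally show ?thesis .
  qed
  then have "real (2 ^ n * (n ^ t - a ^ t) ^ M) = 2 ^ n * (r * real n ^ t) ^ M"
    by (metis of_nat_mult of_nat_numeral of_nat_power)
  also have "\<dots> = 2 ^ n * (r ^ K) ^ n * N"
    by (simp add: N_def M_def power_mult_distrib power_mult[symmetric])
  also have "\<dots> = (2 * r ^ K) ^ n * N" by (simp add: power_mult_distrib)
  also have "(2 * r ^ K) ^ n \<le> (1 / 2) ^ n" using K r by (intro power_mono) auto
  also have "(1 / 2 :: real) ^ n \<le> (1 / 2) ^ 1" using n by (intro power_decreasing) auto
  finally have "real (2 ^ n * (n ^ t - a ^ t) ^ M) \<le> 1 / 2 * N" using N by simp
  then have indep: "real (\<Sum>\<omega>\<in>samples t n M. card (independent_sets t n M a \<omega>)) \<le> 1 / 2 * N"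
    using sum_card_independent_sets[of t n M a] of_nat_le_iff[where 'a = real] order_trans by blast
  \<comment> \<open>The weight \<open>D\<close> handles both conditions at once: the mean of
    \<open>c\<close> is at most C + D/2 < D, and c < D forces the number of independent sets to
    vanish and leaves fewer than D \<le> a dense sets.\<close>
  define c where "c \<omega> = card (dense_index_sets t M m \<omega>) + D * card (independent_sets t n M a \<omega>)" for \<omega>
  have "\<exists>\<omega>\<in>samples t n M. c \<omega> < D"
  proof (rule ccontr)
    assume "\<not> ?thesis"
    then have "(\<Sum>\<omega>\<in>samples t n M. D) \<le> (\<Sum>\<omega>\<in>samples t n M. c \<omega>)"
      by (intro sum_mono) (auto simp: not_less)
    then have "D * n ^ (t * M) \<le> (\<Sum>\<omega>\<in>samples t n M. card (dense_index_sets t M m \<omega>))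
       + D * (\<Sum>\<omega>\<in>samples t n M. card (independent_sets t n M a \<omega>))"
      by (simp add: card_samples c_def sum.distrib sum_distrib_left mult.commute)
    then have "real D * N \<le> real (\<Sum>\<omega>\<in>samples t n M. card (dense_index_sets t M m \<omega>))
       + real D * real (\<Sum>\<omega>\<in>samples t n M. card (independent_sets t n M a \<omega>))"
      unfolding N_def by (metis of_nat_le_iff of_nat_mult of_nat_add of_nat_power)
    also have "\<dots> \<le> real C * N + real D * (1 / 2 * N)"
      by (intro add_mono dense mult_left_mono indep) auto
    finally have "real D * N \<le> (real C + real D / 2) * N" by (simp add: algebra_simps)
    then have "real D \<le> real C + real D / 2" using N by simp
    then show False by (simp add: D_def)
  qed
  then obtain \<omega> where \<omega>: "\<omega> \<in> samples t n M" "c \<omega> < D" by auto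
  have "card (independent_sets t n M a \<omega>) = 0"
    using \<omega>(2) by (cases "card (independent_sets t n M a \<omega>)") (auto simp: c_def)
  then have "card (dense_index_sets t M m \<omega>) < a" "independent_sets t n M a \<omega> = {}"
    using \<omega>(2) a by (auto simp: c_def)
  then show ?thesis using a \<omega>(1) unfolding n_def by blast
qed

section \<open>Cover and matching numbers\<close>

lemma fractional_vertex_cover_number_bounds:
  assumes t: "t \<ge> 1" and T: "uniform_hypergraph t T"
  shows "0 \<le> fractional_vertex_cover_number T"
    and "fractional_vertex_cover_number T \<le> real (card (verts T)) / real t"
proof -
  define X where "X = {(\<Sum>v\<in>verts T. x v) | x. fractional_vertex_cover T x}"
  have "fractional_vertex_cover T (\<lambda>_. 1 / real t)"
    using T t by (auto simp: fractional_vertex_cover_def uniform_hypergraph_def)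
  then have mem: "real (card (verts T)) / real t \<in> X"
    by (auto simp: X_def intro!: exI[of _ "\<lambda>_. 1 / real t"])
  have nonneg: "0 \<le> y" if "y \<in> X" for y
    using that by (auto simp: X_def fractional_vertex_cover_def intro!: sum_nonneg)
  show "0 \<le> fractional_vertex_cover_number T"
    unfolding fractional_vertex_cover_number_def X_def[symmetric]
    using mem nonneg by (intro cInf_greatest) auto
  show "fractional_vertex_cover_number T \<le> real (card (verts T)) / real t"
    unfolding fractional_vertex_cover_number_def X_def[symmetric]
    using mem bdd_belowI[of X 0] nonneg by (intro cInf_lower) auto
qed

lemma matching_number_le:
  assumes t: "t \<ge> 1" and T: "uniform_hypergraph t T"
  shows "t * matching_number T \<le> card (verts T)"
proof -
  have fin: "finite (verts T)" and E: "\<Union>(edges T) \<subseteq> verts T"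
    using T by (auto simp: uniform_hypergraph_def hypergraph_def)
  then have finE: "finite (edges T)" by (meson finite_UnionD finite_subset)
  have "{card M | M. matching T M} = card ` {M. matching T M}" by auto
  moreover have "finite {M. matching T M}"
    by (rule finite_subset[of _ "Pow (edges T)"]) (auto simp: matching_def finE)
  moreover have "{} \<in> {M. matching T M}" by (simp add: matching_def)
  ultimately have "matching_number T \<in> card ` {M. matching T M}"
    unfolding matching_number_def by (metis Max_in empty_iff finite_imageI imageI)
  then obtain M where M: "M \<subseteq> edges T" "disjoint M" "matching_number T = card M"
    by (auto simp: matching_def)
  have cM: "card e = t" "finite e" if "e \<in> M" for e
  proof -
    show "card e = t" using that M T by (auto simp: uniform_hypergraph_def)
    then show "finite e" using t by (intro card_ge_0_finite) simp
  qed
  have "card (\<Union>M) = (\<Sum>e\<in>M. card e)"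
    using M cM by (intro card_Union_disjoint) (auto simp: disjoint_def pairwise_def disjnt_def)
  also have "\<dots> = t * card M" using cM by (simp add: mult.commute)
  finally have "t * matching_number T = card (\<Union>M)" using M by simp
  also have "\<dots> \<le> card (verts T)" using M E fin by (intro card_mono) auto
  finally show ?thesis .
qed

lemma vertex_cover_number_attained:
  assumes t: "t \<ge> 1" and T: "uniform_hypergraph t T"
  shows "\<exists>C. vertex_cover T C \<and> vertex_cover_number T = card C"
proof -
  have fin: "finite (verts T)"
    using T by (auto simp: uniform_hypergraph_def hypergraph_def)
  have "{card C | C. vertex_cover T C} = card ` {C. vertex_cover T C}" by auto
  moreover have "finite {C. vertex_cover T C}"
    by (rule finite_subset[of _ "Pow (verts T)"]) (auto simp: vertex_cover_def fin)
  moreover have "verts T \<inter> e \<noteq> {}" if "e \<in> edges T" for e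
  proof -
    have "e \<subseteq> verts T" "card e = t" using that T by (auto simp: uniform_hypergraph_def hypergraph_def)
    then show ?thesis using t by (auto simp: Int_absorb1)
  qed
  then have "verts T \<in> {C. vertex_cover T C}" by (simp add: vertex_cover_def)
  ultimately have "vertex_cover_number T \<in> card ` {C. vertex_cover T C}"
    unfolding vertex_cover_number_def by (metis Min_in empty_iff finite_imageI imageI)
  then show ?thesis by auto
qed

text \<open>An isomorphism onto a sub-hypergraph is injective on vertices, so a dense set of edges
  is carried to a dense one.\<close>

lemma contains_subhypergraph_edges:
  assumes F: "hypergraph F" and con: "contains_subhypergraph T F" and S: "S \<subseteq> edges F"
  shows "\<exists>S'\<subseteq>edges T. card S' = card S \<and> card (\<Union>S') = card (\<Union>S)"
proof -
  obtain K where K: "edges K \<subseteq> edges T" "hypergraph_iso F K"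
    using con by (auto simp: contains_subhypergraph_def)
  then obtain f where f: "inj_on f (verts F)" "edges K = (\<lambda>e. f ` e) ` edges F"
    by (auto simp: hypergraph_iso_def bij_betw_def)
  have sub: "\<Union>S \<subseteq> verts F" using F S by (auto simp: hypergraph_def)
  have "inj_on ((`) f) S"
    using inj_on_subset[OF inj_on_image_Pow[OF f(1)]] sub by blast
  moreover have "\<Union>((`) f ` S) = f ` \<Union>S" by auto
  moreover have "card (f ` \<Union>S) = card (\<Union>S)"
    using inj_on_subset[OF f(1) sub] by (rule card_image)
  ultimately show ?thesis
    using K(1) image_mono[OF S, of "(`) f"] unfolding f(2)
    by (intro exI[of _ "(`) f ` S"]) (simp add: card_image)
qed

section \<open>Sparse hypergraphs with small independence number\<close>

text \<open>The deletion method: one index is removed from each dense index set of a good sample,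
  fewer than \<open>a\<close> in total. The complement of a vertex cover contains no surviving edge;
  dropping from it one vertex of each deleted edge makes it independent in the full sample, so it
  had fewer than 2a vertices.\<close>

lemma ex_sparse_hypergraph:
  assumes t: "t \<ge> 1" and q: "q \<ge> 2"
  shows "\<exists>(T :: nat hypergraph) a. uniform_hypergraph t T \<and> edges T \<noteq> {} \<and>
    card (verts T) = q * a \<and> q * a \<le> vertex_cover_number T + 2 * a \<and>
    (\<forall>S\<subseteq>edges T. S \<noteq> {} \<and> card S \<le> m \<longrightarrow> card (\<Union>S) > (t - 1) * card S)"
proof -
  \<comment> \<open>\<open>Suc m\<close> instead of m guarantees that singletons are among the dense
    index sets even for m = 0, so every surviving edge has exactly t vertices.\<close>
  obtain a M \<omega> where a: "a > 0" and \<omega>: "\<omega> \<in> samples t (q * a) M"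
    and dense: "card (dense_index_sets t M (Suc m) \<omega>) < a"
    and indep: "independent_sets t (q * a) M a \<omega> = {}"
    using ex_sample[of t q "Suc m"] t q by auto
  define n where "n = q * a"
  define R where "R = (\<lambda>I. SOME i. i \<in> I) ` dense_index_sets t M (Suc m) \<omega>"
  define I0 where "I0 = {..<M} - R"
  define T where "T = \<lparr>verts = {..<n}, edges = edge t \<omega> ` I0\<rparr>"
  have finR: "finite R" by (simp add: R_def)
  have cR: "card R < a" using dense card_image_le[OF finite_dense_index_sets] unfolding R_def
    by (rule order.strict_trans1[rotated])
  have RM: "R \<subseteq> {..<M}"
  proof
    fix i assume "i \<in> R"
    then obtain I where "I \<in> dense_index_sets t M (Suc m) \<omega>" "i = (SOME i. i \<in> I)"
      by (auto simp: R_def)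
    then have "I \<subseteq> {..<M}" "i \<in> I" by (auto simp: dense_index_sets_def some_in_eq)
    then show "i \<in> {..<M}" by auto
  qed
  have sparse: "card (\<Union>i\<in>I. edge t \<omega> i) > (t - 1) * card I"
    if "I \<subseteq> I0" "I \<noteq> {}" "card I \<le> Suc m" for I
  proof (rule ccontr)
    assume "\<not> ?thesis"
    then have "I \<in> dense_index_sets t M (Suc m) \<omega>"
      using that by (auto simp: dense_index_sets_def I0_def)
    then have "(SOME i. i \<in> I) \<in> R" by (auto simp: R_def)
    moreover have "(SOME i. i \<in> I) \<in> I" using that by (simp add: some_in_eq)
    ultimately show False using that by (auto simp: I0_def)
  qed
  have "card (edge t \<omega> i) = t" if "i \<in> I0" for i
  proof (rule antisym)
    show "card (edge t \<omega> i) \<le> t" using card_image_le[of "{..<t}" "\<omega> i"] by (simp add: edge_def)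
    show "t \<le> card (edge t \<omega> i)" using sparse[of "{i}"] that by simp
  qed
  then have T: "uniform_hypergraph t T"
    using edge_subset[OF \<omega>] by (auto simp: T_def uniform_hypergraph_def hypergraph_def n_def I0_def)
  have cover: "n < card C + 2 * a" if C: "vertex_cover T C" for C
  proof -
    define A where "A = {..<n} - C"
    \<comment> \<open>Coordinate 0, which exists as t \<ge> 1, supplies the vertex dropped for each
      deleted edge.\<close>
    define W where "W = (\<lambda>i. \<omega> i 0) ` R"
    have "card W < a" using cR card_image_le[OF finR] unfolding W_def
      by (rule order.strict_trans1[rotated])
    have noedge: "\<not> edge t \<omega> i \<subseteq> A - W" if "i < M" for i
    proof (cases "i \<in> R")
      case True
      then have "\<omega> i 0 \<in> W" "\<omega> i 0 \<in> edge t \<omega> i" using t by (auto simp: W_def edge_def)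
      then show ?thesis by auto
    next
      case False
      then have "C \<inter> edge t \<omega> i \<noteq> {}" using C that by (auto simp: vertex_cover_def T_def I0_def)
      then show ?thesis by (auto simp: A_def)
    qed
    have "card (A - W) < a"
    proof (rule ccontr)
      assume "\<not> ?thesis"
      then obtain B where B: "B \<subseteq> A - W" "card B = a"
        using obtain_subset_with_card_n[of a "A - W"] by (auto simp: not_less)
      then have "B \<in> independent_sets t (q * a) M a \<omega>"
        using noedge by (auto simp: independent_sets_def A_def n_def)
      then show False using indep by simp
    qed
    moreover have "card A \<le> card (A - W) + card W"
      using diff_card_le_card_Diff[of W A] finR by (simp add: W_def)
    moreover have "card A = n - card C"
      using C by (auto simp: A_def vertex_cover_def T_def card_Diff_subset finite_subset)
    ultimately show ?thesis using \<open>card W < a\<close> by linarith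
  qed
  \<comment> \<open>Without edges the empty set would be a cover, giving q a < 2a.\<close>
  have "edges T \<noteq> {}"
  proof
    assume "edges T = {}"
    then have "n < 2 * a" using cover[of "{}"] by (simp add: vertex_cover_def)
    then show False using q by (simp add: n_def)
  qed
  moreover have "n \<le> vertex_cover_number T + 2 * a"
    using vertex_cover_number_attained[OF t T] cover by (metis less_imp_le)
  moreover have "card (\<Union>S) > (t - 1) * card S"
    if S: "S \<subseteq> edges T" "S \<noteq> {}" "card S \<le> m" for S
  proof -
    \<comment> \<open>Different indices may carry the same edge; one index per edge is kept, so that
      \<open>I\<close> has as many elements as \<open>S\<close>.\<close>
    obtain I where I: "I \<subseteq> I0" "inj_on (edge t \<omega>) I" "S = edge t \<omega> ` I"
      using S(1) by (auto simp: T_def subset_image_inj)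
    then show ?thesis using sparse[of I] S by (simp add: card_image)
  qed
  moreover have "card (verts T) = n" by (simp add: T_def)
  ultimately show ?thesis using T unfolding n_def by blast
qed

theorem theorem1p2:
  fixes t :: nat and \<epsilon> :: real and \<F> :: "'a hypergraph set"
  assumes "t \<ge> 2"
    and "\<epsilon> > 0"
    and "finite \<F>"
    and "\<forall>F\<in>\<F>. uniform_hypergraph t F"
    and "\<forall>F\<in>\<F>. \<forall>G :: nat hypergraph. uniform_hypergraph t G \<longrightarrow>
           \<not> contains_subhypergraph (blown_up (t - 1) G) F"
  shows "\<exists>T :: nat hypergraph. uniform_hypergraph t T \<and> edges T \<noteq> {} \<and>
           (\<forall>F\<in>\<F>. \<not> contains_subhypergraph T F) \<and>
           real (vertex_cover_number T) \<ge> (real t - \<epsilon>) * fractional_vertex_cover_number T \<and>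
           real (vertex_cover_number T) \<ge> (real t - \<epsilon>) * real (matching_number T)"
proof -
  \<comment> \<open>The choice of q makes the loss 2a affordable: \<epsilon> q \<ge> 2t gives (t -
    \<epsilon>) q a / t \<le> q a - 2a. The summand 2 in \<open>q\<close> secures q \<ge> 2.\<close>
  obtain q0 :: nat where q0: "2 * real t / \<epsilon> \<le> real q0" using real_arch_simple[of "2 * real t / \<epsilon>"] by blast
  define q where "q = q0 + 2"
  have q: "2 * real t \<le> \<epsilon> * real q" "q \<ge> 2"
    using q0 assms(2) by (auto simp: q_def field_simps)
  \<comment> \<open>Any upper bound for the edge numbers of all members of the family will
    do.\<close>
  define m where "m = (\<Sum>F\<in>\<F>. card (edges F))"
  have t: "t \<ge> 1" using assms(1) by simp
  obtain T :: "nat hypergraph" and a where T: "uniform_hypergraph t T" "edges T \<noteq> {}"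
    and n: "card (verts T) = q * a" and cover: "q * a \<le> vertex_cover_number T + 2 * a"
    and sparse: "\<And>S. S \<subseteq> edges T \<Longrightarrow> S \<noteq> {} \<Longrightarrow> card S \<le> m \<Longrightarrow> card (\<Union>S) > (t - 1) * card S"
    using ex_sparse_hypergraph[OF t q(2), of m] by blast
  have "\<not> contains_subhypergraph T F" if F: "F \<in> \<F>" for F
  proof
    assume con: "contains_subhypergraph T F"
    have uF: "uniform_hypergraph t F" using assms(4) F by auto
    then have hF: "hypergraph F" by (simp add: uniform_hypergraph_def)
    then have "finite (verts F)" "\<Union>(edges F) \<subseteq> verts F" by (auto simp: hypergraph_def)
    then have fin: "finite (edges F)" by (meson finite_UnionD finite_subset)
    obtain S where S: "S \<subseteq> edges F" "S \<noteq> {}" "card (\<Union>S) \<le> (t - 1) * card S"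
      using dense_edges_if_not_in_blown_up[OF assms(1) uF] assms(5) F by blast
    obtain S' where S': "S' \<subseteq> edges T" "card S' = card S" "card (\<Union>S') = card (\<Union>S)"
      using contains_subhypergraph_edges[OF hF con S(1)] by blast
    have "finite S" using S fin finite_subset by auto
    then have "S' \<noteq> {}" using S S' by auto
    moreover have "card S \<le> card (edges F)" using S fin by (simp add: card_mono)
    moreover have "card (edges F) \<le> m"
      unfolding m_def using F assms(3) by (intro member_le_sum) auto
    ultimately show False using sparse[of S'] S S' by auto
  qed
  \<comment> \<open>Stated for every y between 0 and n/t, so that it serves both \<tau>* and \<nu>.
    Nonnegativity of y covers the case t \<le> \<epsilon>, where the factor t - \<epsilon> is not
    positive.\<close>
  moreover have bound: "(real t - \<epsilon>) * y \<le> real (vertex_cover_number T)"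
    if y: "0 \<le> y" "y \<le> real (q * a) / real t" for y
  proof (cases "real t \<le> \<epsilon>")
    case True
    then have "(real t - \<epsilon>) * y \<le> 0" using y by (simp add: mult_nonpos_nonneg)
    then show ?thesis by linarith
  next
    case False
    then have "(real t - \<epsilon>) * y \<le> (real t - \<epsilon>) * (real (q * a) / real t)"
      using y by (intro mult_left_mono) auto
    also have "\<dots> = real (q * a) - \<epsilon> * real q * real a / real t"
      using t by (simp add: field_simps)
    also have "2 * real a \<le> \<epsilon> * real q * real a / real t"
      using mult_right_mono[OF q(1), of "real a"] t by (simp add: field_simps)
    then have "real (q * a) - \<epsilon> * real q * real a / real t \<le> real (q * a) - 2 * real a" by simp
    also have "\<dots> \<le> real (vertex_cover_number T)"
    proof -
      have "real (q * a) \<le> real (vertex_cover_number T + 2 * a)" using cover by (rule of_nat_mono)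
      then show ?thesis by simp
    qed
    finally show ?thesis .
  qed
  moreover have "real (matching_number T) \<le> real (q * a) / real t"
  proof -
    have "real (t * matching_number T) \<le> real (q * a)"
      using matching_number_le[OF t T(1)] n by (metis of_nat_le_iff)
    then show ?thesis using t by (simp add: field_simps)
  qed
  moreover have "0 \<le> fractional_vertex_cover_number T"
    "fractional_vertex_cover_number T \<le> real (q * a) / real t"
    using fractional_vertex_cover_number_bounds[OF t T(1)] n by auto
  ultimately show ?thesis using T of_nat_0_le_iff by blast
qed

end
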